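(* Consider two targets $t_1,t_2$ and biased vertex-direction and edge-direction queries with constant probabilities $p_1>p_2=1-p_1>0$. Given $t_1$, the algorithm $\mathcal{E}$ (described in the context) detects $t_2$ in at most $O(\log^2 n)$ vertex-direction queries and $O(\log^3 n)$ edge-direction queries with probability at least $1-O\left(\log n\cdot p_1^{\log n}\right)$, where $n$ is the number of vertices of the graph.
   Context: All logarithms are base $2$. Graphs $G=(V,E)$, $|V|=n$, are connected, simple, undirected, with positive edge weights $w$; $d$ is the shortest-path distance, and $N(v)$ is the set of neighbors of $v$. For $u\in N(v)$, $N(v,u)=\{x\in V: d(v,x)=w(vu)+d(u,x)\}$. There are two targets $t_1,t_2\in V$. A vertex-direction query at $v$ independently returns, with probability $p_i$, a neighbor $u\in N(v)$ with $t_i\in N(v,u)$ (an arbitrary one, possibly chosen adversarially, if several exist), without disclosing $i$; if $v=t_i$, this is revealed by the query with probability $p_i$. An edge-direction query at an ordered pair $(v,u)$ of adjacent vertices independently returns, with probability $p_i$, YES if $t_i\in N(v,u)$ and NO if $t_i\notin N(v,u)$, without disclosing $i$. Let $E_{t_1}(v)=\{u\in N(v):t_1\in N(v,u)\}$. For $S\subseteq V$ and $v\in V$, $\Gamma_S(v)=\max\{|N(v,u)\cap S|:u\in N(v)\}$. For a fixed constant $0\le\varepsilon<1$, a $(1+\varepsilon)$-median of $S$ for $\Gamma$ is a vertex $x\in V$ with $\Gamma_S(x)\le(1+\varepsilon)\min_{v\in V}\Gamma_S(v)$. Algorithm $\mathcal{E}$ ($t_1$ is known). Set $S\leftarrow V$.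 While $|S|>1$: compute an (exact or $(1+\varepsilon)$-approximate) median $v$ of $S$ with respect to $\Gamma$ and the set $E_{t_1}(v)$; apply $\log n$ vertex-direction queries at $v$, and let $Q(v)$ be the set of different responses. If there is a vertex $u\in Q(v)$ with $u\notin E_{t_1}(v)$, set $S\leftarrow S\cap N(v,u)$. Otherwise, for every $u\in Q(v)$: apply $\log n$ edge-direction queries at $(v,u)$, and let $Q(v,u)$ be the set of different responses; if $Q(v,u)=\{\text{YES}\}$, then set $S\leftarrow S\cap N(v,u)$ and go to the next iteration of the while loop. When $|S|=1$, return the unique vertex of $S$. If a query reveals that the queried vertex is $t_2$, then $t_2$ is detected. The constants in $O(\cdot)$ may depend on $p_1$ and $\varepsilon$.
   Formalization: The loop "for every u in Q(v)" is run in order of first appearance among the responses, since for an arbitrary order the stated probability bound can fail; log n repetitions means its ceiling, and vertices are natural numbers (any finite graph up to relabelling). *)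

theory Defs
  imports
    "HOL-Probability.SPMF"
    "HOL-Library.Monad_Syntax"
    "Graph_Theory.Digraph_Component"
    "Graph_Theory.Pair_Digraph"
    "Graph_Theory.Shortest_Path"
begin

section \<open>Weighted graphs, directions and medians\<close>

text \<open>
  A simple undirected graph is a symmetric, loop-free finite digraph whose arcs are ordered pairs,
  so that every edge is represented by its two orientations; these carry the same weight.
\<close>

definition weighted_graph :: "'a pair_pre_digraph \<Rightarrow> ('a \<times> 'a) weight_fun \<Rightarrow> bool" where
  "weighted_graph G w \<longleftrightarrow>
     pair_graph G \<and> Digraph_Component.connected (with_proj G) \<and>
     (\<forall>u v. (u, v) \<in> parcs G \<longrightarrow> w (u, v) > 0 \<and> w (u, v) = w (v, u))"

definition distance :: "'a pair_pre_digraph \<Rightarrow> ('a \<times> 'a) weight_fun \<Rightarrow> 'a \<Rightarrow> 'a \<Rightarrow> ereal" where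
  "distance G w = wf_digraph.\<mu> (with_proj G) w"

definition neighbors :: "'a pair_pre_digraph \<Rightarrow> 'a \<Rightarrow> 'a set" where
  "neighbors G v = {u. (v, u) \<in> parcs G}"

text \<open>\<open>direction G w v u\<close> is $N(v,u)$ and \<open>towards G w x v\<close> is $E_x(v)$.\<close>

definition direction :: "'a pair_pre_digraph \<Rightarrow> ('a \<times> 'a) weight_fun \<Rightarrow> 'a \<Rightarrow> 'a \<Rightarrow> 'a set" where
  "direction G w v u = {x \<in> pverts G. distance G w v x = ereal (w (v, u)) + distance G w u x}"

definition towards :: "'a pair_pre_digraph \<Rightarrow> ('a \<times> 'a) weight_fun \<Rightarrow> 'a \<Rightarrow> 'a \<Rightarrow> 'a set" where
  "towards G w x v = {u \<in> neighbors G v. x \<in> direction G w v u}"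

text \<open>
  The maximum ranges over an empty set only in the one-vertex graph, where no median is computed.
\<close>

definition Gamma :: "'a pair_pre_digraph \<Rightarrow> ('a \<times> 'a) weight_fun \<Rightarrow> 'a set \<Rightarrow> 'a \<Rightarrow> nat" where
  "Gamma G w S v = Max ((\<lambda>u. card (direction G w v u \<inter> S)) ` neighbors G v)"

definition approx_median ::
  "'a pair_pre_digraph \<Rightarrow> ('a \<times> 'a) weight_fun \<Rightarrow> real \<Rightarrow> 'a set \<Rightarrow> 'a \<Rightarrow> bool" where
  "approx_median G w \<epsilon> S x \<longleftrightarrow>
     x \<in> pverts G \<and> real (Gamma G w S x) \<le> (1 + \<epsilon>) * real (Min (Gamma G w S ` pverts G))"


section \<open>Noisy queries\<close>

datatype target = First | Second

definition choose_target :: "real \<Rightarrow> target pmf" where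
  "choose_target p1 = map_pmf (\<lambda>b. if b then First else Second) (bernoulli_pmf p1)"

text \<open>
  \<open>Is_Target i\<close> is the answer revealing that the queried vertex is \<open>t i\<close>.
\<close>

datatype 'a response = Neighbor 'a | Is_Target target

text \<open>
  The transcript of a run, most recent query first.  It records the hidden target of every query as
  well as the answer.  All choices left open (which of several correct answers is returned, which
  median is taken, ...) are made by rules that may depend on the whole transcript, hidden targets
  included.
\<close>

datatype 'a query =
    is_vertex_query: Vertex_Query 'a target "'a response"
  | is_edge_query: Edge_Query 'a 'a target bool

type_synonym 'a transcript = "'a query list"

definition num_vertex_queries :: "'a transcript \<Rightarrow> nat" where
  "num_vertex_queries h = length (filter is_vertex_query h)"

definition num_edge_queries :: "'a transcript \<Rightarrow> nat" where
  "num_edge_queries h = length (filter is_edge_query h)"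

type_synonym 'a adversary = "'a transcript \<Rightarrow> target \<Rightarrow> 'a \<Rightarrow> 'a"

definition correct_adversary ::
  "'a pair_pre_digraph \<Rightarrow> ('a \<times> 'a) weight_fun \<Rightarrow> (target \<Rightarrow> 'a) \<Rightarrow> 'a adversary \<Rightarrow> bool" where
  "correct_adversary G w t adv \<longleftrightarrow>
     (\<forall>h i. \<forall>v \<in> pverts G. v \<noteq> t i \<longrightarrow> adv h i v \<in> towards G w (t i) v)"

definition vertex_query ::
  "real \<Rightarrow> (target \<Rightarrow> 'a) \<Rightarrow> 'a adversary \<Rightarrow> 'a \<Rightarrow> 'a transcript
     \<Rightarrow> ('a response \<times> 'a transcript) pmf" where
  "vertex_query p1 t adv v h = do {
     i \<leftarrow> choose_target p1;
     let r = (if v = t i then Is_Target i else Neighbor (adv h i v));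
     return_pmf (r, Vertex_Query v i r # h)
   }"

text \<open>The answer \<open>True\<close> is YES.\<close>

definition edge_query ::
  "'a pair_pre_digraph \<Rightarrow> ('a \<times> 'a) weight_fun \<Rightarrow> real \<Rightarrow> (target \<Rightarrow> 'a) \<Rightarrow> 'a \<Rightarrow> 'a
     \<Rightarrow> 'a transcript \<Rightarrow> (bool \<times> 'a transcript) pmf" where
  "edge_query G w p1 t v u h = do {
     i \<leftarrow> choose_target p1;
     let b = (t i \<in> direction G w v u);
     return_pmf (b, Edge_Query v u i b # h)
   }"

primrec repeat_query ::
  "nat \<Rightarrow> ('h \<Rightarrow> ('r \<times> 'h) pmf) \<Rightarrow> 'h \<Rightarrow> ('r list \<times> 'h) pmf" where
  "repeat_query 0 q h = return_pmf ([], h)"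
| "repeat_query (Suc k) q h = do {
     (r, h') \<leftarrow> q h;
     (rs, h'') \<leftarrow> repeat_query k q h';
     return_pmf (r # rs, h'')
   }"


section \<open>The search for the second target when the first one is known\<close>

definition num_repetitions :: "'a pair_pre_digraph \<Rightarrow> nat" where
  "num_repetitions G = nat \<lceil>log 2 (real (card (pverts G)))\<rceil>"

text \<open>
  Arbitrary choices of the search: which approximate median is computed, and which vertex of
  $Q(v) \setminus E_{t_1}(v)$ is used.
\<close>

type_synonym 'a median_rule = "'a transcript \<Rightarrow> 'a set \<Rightarrow> 'a"
type_synonym 'a pick_rule = "'a transcript \<Rightarrow> 'a set \<Rightarrow> 'a"

definition correct_median_rule ::
  "'a pair_pre_digraph \<Rightarrow> ('a \<times> 'a) weight_fun \<Rightarrow> real \<Rightarrow> 'a median_rule \<Rightarrow> bool" where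
  "correct_median_rule G w \<epsilon> med \<longleftrightarrow>
     (\<forall>h S. S \<subseteq> pverts G \<longrightarrow> card S > 1 \<longrightarrow> approx_median G w \<epsilon> S (med h S))"

definition correct_pick_rule :: "'a pick_rule \<Rightarrow> bool" where
  "correct_pick_rule pick \<longleftrightarrow> (\<forall>h A. finite A \<longrightarrow> A \<noteq> {} \<longrightarrow> pick h A \<in> A)"

text \<open>
  The different neighbors among the responses, in the order in which they were first returned;
  this is the order in which the edge tests are run.  The order affects the failure probability: a
  response on the way to the second target always passes its test and ends the iteration, whereas
  each wrong one tested before it passes with probability $p_1^{\log n}$.  In order of first
  appearance, only a bounded expected number of wrong responses come first.
\<close>

definition distinct_neighbors :: "'a response list \<Rightarrow> 'a list" where
  "distinct_neighbors rs = rev (remdups (rev [u. Neighbor u \<leftarrow> rs]))"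

primrec test_edges ::
  "'a pair_pre_digraph \<Rightarrow> ('a \<times> 'a) weight_fun \<Rightarrow> real \<Rightarrow> (target \<Rightarrow> 'a) \<Rightarrow> 'a \<Rightarrow> 'a list
     \<Rightarrow> 'a transcript \<Rightarrow> ('a option \<times> 'a transcript) pmf" where
  "test_edges G w p1 t v [] h = return_pmf (None, h)"
| "test_edges G w p1 t v (u # us) h = do {
     (bs, h') \<leftarrow> repeat_query (num_repetitions G) (edge_query G w p1 t v u) h;
     if set bs = {True} then return_pmf (Some u, h') else test_edges G w p1 t v us h'
   }"

text \<open>
  One iteration of the while loop: \<open>Detected x\<close> means that a query revealed \<open>x\<close> to be the second
  target, \<open>Candidates S\<close> is the new set $S$.
\<close>

datatype 'a outcome = Detected 'a | Candidates "'a set"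

definition iteration ::
  "'a pair_pre_digraph \<Rightarrow> ('a \<times> 'a) weight_fun \<Rightarrow> real \<Rightarrow> (target \<Rightarrow> 'a) \<Rightarrow> 'a adversary
     \<Rightarrow> 'a median_rule \<Rightarrow> 'a pick_rule \<Rightarrow> 'a set \<Rightarrow> 'a transcript
     \<Rightarrow> ('a outcome \<times> 'a transcript) pmf" where
  "iteration G w p1 t adv med pick S h = (
     let v = med h S; E = towards G w (t First) v in do {
       (rs, h') \<leftarrow> repeat_query (num_repetitions G) (vertex_query p1 t adv v) h;
       let Q = distinct_neighbors rs;
       if Is_Target Second \<in> set rs then return_pmf (Detected v, h')
       else if \<exists>u \<in> set Q. u \<notin> E then
         return_pmf (Candidates (S \<inter> direction G w v (pick h' (set Q - E))), h')
       else do {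
         (res, h'') \<leftarrow> test_edges G w p1 t v Q h';
         return_pmf
           (Candidates (case res of None \<Rightarrow> S | Some u \<Rightarrow> S \<inter> direction G w v u), h'')
       }
     })"

text \<open>
  A run yields the detected vertex together with the transcript.  The value \<open>None\<close> covers the case
  that $S$ has become empty; the missing mass of the subprobability is that of the
  non-terminating runs.
\<close>

partial_function (spmf) search ::
  "'a pair_pre_digraph \<Rightarrow> ('a \<times> 'a) weight_fun \<Rightarrow> real \<Rightarrow> (target \<Rightarrow> 'a) \<Rightarrow> 'a adversary
     \<Rightarrow> 'a median_rule \<Rightarrow> 'a pick_rule \<Rightarrow> 'a set \<Rightarrow> 'a transcript
     \<Rightarrow> ('a option \<times> 'a transcript) spmf" where
  "search G w p1 t adv med pick S h =
     (if card S > 1 then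
        bind_spmf (spmf_of_pmf (iteration G w p1 t adv med pick S h))
          (\<lambda>(res, h'). case res of
             Detected x \<Rightarrow> return_spmf (Some x, h')
           | Candidates S' \<Rightarrow> search G w p1 t adv med pick S' h')
      else return_spmf (if card S = 1 then Some (the_elem S) else None, h))"

definition algorithm_E ::
  "'a pair_pre_digraph \<Rightarrow> ('a \<times> 'a) weight_fun \<Rightarrow> real \<Rightarrow> (target \<Rightarrow> 'a) \<Rightarrow> 'a adversary
     \<Rightarrow> 'a median_rule \<Rightarrow> 'a pick_rule \<Rightarrow> ('a option \<times> 'a transcript) spmf" where
  "algorithm_E G w p1 t adv med pick = search G w p1 t adv med pick (pverts G) []"

end

theory Submission
  imports Defs
begin

text \<open>
  A vertex minimizing the total distance to $S$ has $\Gamma_S \le |S|/2$, so every successful iteration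
  shrinks $S$ by the factor $(1+\varepsilon)/2 < 1$ and $O(\log n)$ of them suffice; the query bounds are
  then deterministic.  Call a response right if it points towards $t_2$.  A response outside
  $E_{t_1}(v)$ is always right, and a right response inside $E_{t_1}(v)$ passes its edge test with
  certainty.  Hence an iteration fails only if no query hits $t_2$, or if a wrong response tested
  before the first right one passes its test.  Each wrong response passes with probability at most $p_1^{\log n}$, and
  the expected number of responses before the first query hitting $t_2$ is at most $p_1/(1-p_1)$, so the
  failure probability of an iteration is at most $p_1^{\log n}(1 + p_1/(1-p_1))$.
\<close>

section \<open>Distances and medians\<close>

locale weighted_pair_graph =
  fixes G :: "'a pair_pre_digraph" and w :: "('a \<times> 'a) weight_fun"
  assumes weighted_graph: "weighted_graph G w"
begin

sublocale pair_graph G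
  using weighted_graph by (simp add: weighted_graph_def)

lemma weight_pos: "(u, v) \<in> parcs G \<Longrightarrow> w (u, v) > 0"
  and weight_sym: "(u, v) \<in> parcs G \<Longrightarrow> w (u, v) = w (v, u)"
  using weighted_graph by (auto simp: weighted_graph_def)

lemma arc_sym: "(u, v) \<in> parcs G \<Longrightarrow> (v, u) \<in> parcs G"
  by (simp add: arcs_symmetric)

text \<open>Connectedness is defined through the symmetric closure, and closing an already symmetric
  arc set changes nothing.\<close>

lemma all_reachable:
  assumes "u \<in> pverts G" "v \<in> pverts G"
  shows "u \<rightarrow>\<^sup>*\<^bsub>with_proj G\<^esub> v"
proof -
  have "strongly_connected (mk_symmetric (with_proj G))"
    using weighted_graph by (simp add: weighted_graph_def Digraph_Component.connected_def)
  then have "u \<rightarrow>\<^sup>*\<^bsub>mk_symmetric (with_proj G)\<^esub> v"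
    using assms by (auto simp: strongly_connected_def)
  then show ?thesis
    by (simp only: reachable_mk_symmetric_eq[OF sym_arcs])
qed

lemma neighbors_subset: "neighbors G v \<subseteq> pverts G"
  using in_arcsD2 by (auto simp: neighbors_def)

lemma finite_neighbors [simp]: "finite (neighbors G v)"
  by (rule finite_subset[OF neighbors_subset]) simp

text \<open>The first arc of a walk to some other vertex leads to a neighbor. This keeps the maximum
  in \<open>Gamma\<close> from ranging over an empty set.\<close>

lemma neighbors_nonempty:
  assumes "v \<in> pverts G" "card (pverts G) > 1"
  shows "neighbors G v \<noteq> {}"
proof -
  have "\<not> pverts G \<subseteq> {v}"
    using assms(2) card_mono[of "{v}" "pverts G"] by auto
  then obtain x where x: "x \<in> pverts G" "x \<noteq> v" by blast
  from all_reachable[OF assms(1) x(1)] show ?thesis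
    using x(2) by (cases rule: converse_reachable_cases) (auto simp: neighbors_def)
qed

text \<open>Weights are nonnegative, so the infimum over walks is attained, by a path. In particular
  distances between vertices are finite.\<close>

lemma distance_shortest_walk:
  assumes "u \<in> pverts G" "v \<in> pverts G"
  obtains p where "awalk u p v" "distance G w u v = ereal (awalk_cost w p)"
proof -
  have nonneg: "w e \<ge> 0" if "e \<in> parcs G" for e
    using weight_pos[of "fst e" "snd e"] that by simp
  obtain p where p: "apath u p v" "\<mu> w u v = awalk_cost w p"
    using min_cost_awalk[OF all_reachable[OF assms], of w] nonneg by auto
  then show thesis by (intro that) (auto simp: apath_def distance_def)
qed

text \<open>Distances between vertices are finite, so they may be taken as reals; sums and
  differences of distances then obey ordinary arithmetic.\<close>

definition real_distance :: "'a \<Rightarrow> 'a \<Rightarrow> real" where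
  "real_distance u v = real_of_ereal (distance G w u v)"

lemma distance_eq_real_distance: "u \<in> pverts G \<Longrightarrow> v \<in> pverts G \<Longrightarrow> distance G w u v = ereal (real_distance u v)"
  by (erule (1) distance_shortest_walk) (simp add: real_distance_def)

text \<open>Putting the arc in front of a shortest walk from \<open>u\<close> gives a walk from
  \<open>v\<close>; this is the triangle inequality for one edge.\<close>

lemma real_distance_step:
  assumes "(v, u) \<in> parcs G" "x \<in> pverts G"
  shows "real_distance v x \<le> w (v, u) + real_distance u x"
proof -
  have v: "v \<in> pverts G" and u: "u \<in> pverts G"
    using in_arcsD1[OF assms(1)] in_arcsD2[OF assms(1)] by auto
  obtain p where p: "awalk u p x" "distance G w u x = ereal (awalk_cost w p)"
    using distance_shortest_walk[OF u assms(2)] by blast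
  have "awalk v ((v, u) # p) x"
    using p(1) assms(1) v by (simp add: awalk_Cons_iff)
  then have "distance G w v x \<le> ereal (awalk_cost w ((v, u) # p))"
    unfolding distance_def by (rule min_cost_le_walk_cost)
  then show ?thesis
    using p(2) distance_eq_real_distance[OF u assms(2)] distance_eq_real_distance[OF v assms(2)] by simp
qed

lemma mem_direction_iff:
  assumes "u \<in> neighbors G v"
  shows "x \<in> direction G w v u \<longleftrightarrow> x \<in> pverts G \<and> real_distance v x = w (v, u) + real_distance u x"
proof -
  have "v \<in> pverts G" "u \<in> pverts G"
    using assms in_arcsD1 in_arcsD2 by (auto simp: neighbors_def)
  then show ?thesis by (auto simp: direction_def distance_eq_real_distance)
qed

text \<open>
  Take a minimizer of the total distance to $S$: moving along an edge of weight $c$ from $v$ to $u$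
  brings the vertices of $N(v,u)$ closer by exactly $c$ and the others at most $c$ further away.
\<close>

lemma exists_halving_vertex:
  assumes "S \<subseteq> pverts G" "pverts G \<noteq> {}"
  shows "\<exists>v \<in> pverts G. \<forall>u \<in> neighbors G v. 2 * card (direction G w v u \<inter> S) \<le> card S"
proof -
  define f where "f v = (\<Sum>s\<in>S. real_distance v s)" for v
  have finS: "finite S" using assms(1) finite_subset[OF _ pair_finite_verts] by blast
  obtain v where v: "v \<in> pverts G" "\<And>u. u \<in> pverts G \<Longrightarrow> f v \<le> f u"
    using ex_min_if_finite[of "f ` pverts G"] assms(2) by (auto simp: not_less)
  have "2 * card (direction G w v u \<inter> S) \<le> card S" if u: "u \<in> neighbors G v" for u
  proof -
    let ?D = "direction G w v u \<inter> S" and ?c = "w (v, u)"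
    have arc: "(v, u) \<in> parcs G" using u by (simp add: neighbors_def)
    \<comment> \<open>Outside \<open>?D\<close> this is the triangle inequality along the reversed
      edge, which has the same weight.\<close>
    have "real_distance u s \<le> real_distance v s + (if s \<in> ?D then - ?c else ?c)" if "s \<in> S" for s
      using that assms(1) real_distance_step[OF arc_sym[OF arc], of s] weight_sym[OF arc]
      by (auto simp: mem_direction_iff[OF u])
    then have "f u \<le> (\<Sum>s\<in>S. real_distance v s + (if s \<in> ?D then - ?c else ?c))"
      unfolding f_def by (intro sum_mono)
    also have "\<dots> = f v + (real (card (S - ?D)) - real (card ?D)) * ?c"
      using finS by (simp add: f_def sum.distrib sum.If_cases algebra_simps Int_commute Diff_eq Int_Un_distrib)
    also have "card (S - ?D) = card S - card ?D"
      using finS by (intro card_Diff_subset) auto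
    finally have "f u \<le> f v + (real (card S - card ?D) - real (card ?D)) * ?c" .
    moreover have "f v \<le> f u" using v(2) u neighbors_subset by blast
    ultimately have "0 \<le> (real (card S - card ?D) - real (card ?D)) * ?c" by linarith
    with weight_pos[OF arc] have "real (card ?D) \<le> real (card S - card ?D)"
      by (simp add: zero_le_mult_iff)
    then show ?thesis by linarith
  qed
  with v(1) show ?thesis by blast
qed

text \<open>The minimum of \<open>Gamma\<close> is at most its value at a halving vertex, hence at
  most half of \<open>card S\<close>; the approximation loses a factor
  \<open>1 + \<epsilon>\<close>.\<close>

lemma approx_median_direction_le:
  assumes "approx_median G w \<epsilon> S x" "S \<subseteq> pverts G" "card (pverts G) > 1" "\<epsilon> \<ge> 0"
    and "u \<in> neighbors G x"
  shows "real (card (S \<inter> direction G w x u)) \<le> (1 + \<epsilon>) / 2 * real (card S)"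
proof -
  have "pverts G \<noteq> {}" using assms(3) by auto
  then obtain v where v: "v \<in> pverts G"
    "\<And>u. u \<in> neighbors G v \<Longrightarrow> 2 * card (direction G w v u \<inter> S) \<le> card S"
    using exists_halving_vertex[OF assms(2)] by blast
  have "Gamma G w S v \<in> (\<lambda>u. card (direction G w v u \<inter> S)) ` neighbors G v"
    unfolding Gamma_def using neighbors_nonempty[OF v(1) assms(3)] by (intro Max_in) auto
  then have half: "2 * Gamma G w S v \<le> card S" using v(2) by auto
  have "real (card (S \<inter> direction G w x u)) \<le> real (Gamma G w S x)"
    unfolding Gamma_def using assms(5) by (auto intro!: Max_ge simp: Int_commute)
  also have "\<dots> \<le> (1 + \<epsilon>) * real (Min (Gamma G w S ` pverts G))"
    using assms(1) by (simp add: approx_median_def)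
  also have "Min (Gamma G w S ` pverts G) \<le> Gamma G w S v"
    using v(1) by (intro Min_le) auto
  finally have "real (card (S \<inter> direction G w x u)) \<le> (1 + \<epsilon>) * real (Gamma G w S v)"
    using assms(4) by (simp add: mult_left_mono)
  moreover have "(1 + \<epsilon>) * (2 * real (Gamma G w S v)) \<le> (1 + \<epsilon>) * real (card S)"
    using half assms(4) by (intro mult_left_mono) linarith+
  ultimately show ?thesis by simp
qed

end


section \<open>Repeated queries\<close>

lemma emeasure_bind_pmf_le_nn_integral:
  assumes "\<And>x. x \<in> set_pmf M \<Longrightarrow> emeasure (measure_pmf (N x)) B \<le> f x"
  shows "emeasure (measure_pmf (bind_pmf M N)) B \<le> (\<integral>\<^sup>+x. f x \<partial>measure_pmf M)"
  unfolding emeasure_bind_pmf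
  by (intro nn_integral_mono_AE) (simp add: AE_measure_pmf_iff assms)

text \<open>A union bound for two stages: on \<open>A\<close> the second stage is bounded by 1, off
  \<open>A\<close> by \<open>c\<close>.\<close>

lemma emeasure_bind_pmf_le_add:
  assumes "\<And>x. x \<in> set_pmf M \<Longrightarrow> x \<notin> A \<Longrightarrow> emeasure (measure_pmf (N x)) B \<le> c"
  shows "emeasure (measure_pmf (bind_pmf M N)) B \<le> emeasure (measure_pmf M) A + c"
proof -
  have "emeasure (measure_pmf (N x)) B \<le> indicator A x + c" if "x \<in> set_pmf M" for x
    using assms[OF that] measure_pmf.emeasure_le_1[of "N x" B]
    by (auto simp: indicator_def intro: add_increasing2)
  then have "emeasure (measure_pmf (bind_pmf M N)) B \<le> (\<integral>\<^sup>+x. indicator A x + c \<partial>measure_pmf M)"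
    by (rule emeasure_bind_pmf_le_nn_integral)
  also have "\<dots> = emeasure (measure_pmf M) A + c"
    by (simp add: nn_integral_add measure_pmf.emeasure_space_1[simplified])
  finally show ?thesis .
qed

lemma nn_integral_choose_target:
  assumes "0 \<le> p" "p \<le> 1"
  shows "(\<integral>\<^sup>+i. f i \<partial>measure_pmf (choose_target p)) = ennreal p * f First + ennreal (1 - p) * f Second"
  using assms by (simp add: choose_target_def mult.commute)

lemma remdups_snoc: "remdups (xs @ [x]) = removeAll x (remdups xs) @ [x]"
  by (induction xs) auto

lemma distinct_neighbors_Nil [simp]: "distinct_neighbors [] = []"
  by (simp add: distinct_neighbors_def)

lemma distinct_neighbors_Is_Target [simp]:
  "distinct_neighbors (Is_Target i # rs) = distinct_neighbors rs"
  by (simp add: distinct_neighbors_def)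

text \<open>\<open>remdups\<close> keeps last occurrences, so between two reversals it keeps first
  ones. This yields a recursion from the front, matching the order of the queries.\<close>

lemma distinct_neighbors_Neighbor [simp]:
  "distinct_neighbors (Neighbor u # rs) = u # removeAll u (distinct_neighbors rs)"
  by (simp add: distinct_neighbors_def remdups_snoc rev_filter removeAll_filter_not_eq)

lemma set_distinct_neighbors: "set (distinct_neighbors rs) = {u. Neighbor u \<in> set rs}"
  by (auto simp: distinct_neighbors_def split: response.splits)

lemma length_distinct_neighbors_le: "length (distinct_neighbors rs) \<le> length rs"
proof (induction rs)
  case (Cons r rs)
  then show ?case
    by (cases r) (auto intro: order_trans[OF length_filter_le] simp: removeAll_filter_not_eq)
qed simp

text \<open>
  An upper bound for the probability of failing when the elements of a list are tried in turn:
  a good one succeeds and ends the process, a bad one is fatal with probability $c$,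
  and so is exhausting the list.
\<close>

primrec first_hit_cost :: "('b \<Rightarrow> bool) \<Rightarrow> real \<Rightarrow> 'b list \<Rightarrow> real" where
  "first_hit_cost P c [] = 1"
| "first_hit_cost P c (x # xs) = (if P x then 0 else c + first_hit_cost P c xs)"

lemma first_hit_cost_nonneg: "c \<ge> 0 \<Longrightarrow> first_hit_cost P c xs \<ge> 0"
  by (induction xs) auto

text \<open>Deleting copies of a bad element only saves their cost, and the first good element
  survives.\<close>

lemma first_hit_cost_removeAll:
  "c \<ge> 0 \<Longrightarrow> \<not> P x \<Longrightarrow> first_hit_cost P c (removeAll x xs) \<le> first_hit_cost P c xs"
  by (induction xs) auto

lemma num_queries_Nil [simp]: "num_vertex_queries [] = 0" "num_edge_queries [] = 0"
  by (auto simp: num_vertex_queries_def num_edge_queries_def)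

lemma num_queries_Cons [simp]:
  "num_vertex_queries (Vertex_Query v i r # h) = Suc (num_vertex_queries h)"
  "num_vertex_queries (Edge_Query v u i b # h) = num_vertex_queries h"
  "num_edge_queries (Vertex_Query v i r # h) = num_edge_queries h"
  "num_edge_queries (Edge_Query v u i b # h) = Suc (num_edge_queries h)"
  by (auto simp: num_vertex_queries_def num_edge_queries_def)


section \<open>Failure probability of the search\<close>

locale two_target_search = weighted_pair_graph G w
  for G :: "'a pair_pre_digraph" and w :: "('a \<times> 'a) weight_fun" +
  fixes p \<epsilon> :: real and t :: "target \<Rightarrow> 'a"
    and adv :: "'a adversary" and med :: "'a median_rule" and pick :: "'a pick_rule"
  assumes p: "0 < p" "p < 1"
    and \<epsilon>: "0 \<le> \<epsilon>" "\<epsilon> < 1"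
    and targets: "t i \<in> pverts G"
    and adv: "correct_adversary G w t adv"
    and med: "correct_median_rule G w \<epsilon> med"
    and pick: "correct_pick_rule pick"
begin

abbreviation "L \<equiv> num_repetitions G"

abbreviation leads_to_second :: "'a \<Rightarrow> 'a \<Rightarrow> bool" where
  "leads_to_second v u \<equiv> t Second \<in> direction G w v u"

text \<open>Revealing the second target counts as a success because it ends the search. Revealing
  the first one counts as bad although it triggers no edge test, which can only raise the estimated
  cost.\<close>

primrec helpful :: "'a \<Rightarrow> 'a response \<Rightarrow> bool" where
  "helpful v (Neighbor u) \<longleftrightarrow> leads_to_second v u"
| "helpful v (Is_Target i) \<longleftrightarrow> i = Second"

text \<open>Isolates the part of a query that is determined by the hidden target, so that a query
  becomes the image of \<open>choose_target p\<close> under a function.\<close>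

definition answer :: "'a transcript \<Rightarrow> target \<Rightarrow> 'a \<Rightarrow> 'a response" where
  "answer h i v = (if v = t i then Is_Target i else Neighbor (adv h i v))"

lemma vertex_query_altdef:
  "vertex_query p t adv v h =
     map_pmf (\<lambda>i. (answer h i v, Vertex_Query v i (answer h i v) # h)) (choose_target p)"
  by (simp add: vertex_query_def answer_def map_pmf_def Let_def)

lemma edge_query_altdef:
  "edge_query G w p t v u h =
     map_pmf (\<lambda>i. (t i \<in> direction G w v u, Edge_Query v u i (t i \<in> direction G w v u) # h))
       (choose_target p)"
  by (simp add: edge_query_def map_pmf_def Let_def)

lemma adv_towards: "v \<in> pverts G \<Longrightarrow> v \<noteq> t i \<Longrightarrow> adv h i v \<in> towards G w (t i) v"
  using adv by (auto simp: correct_adversary_def)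

lemma helpful_answer_Second: "v \<in> pverts G \<Longrightarrow> helpful v (answer h Second v)"
  using adv_towards[of v Second h] by (auto simp: answer_def towards_def)

section \<open>Query counts and possible answers, for every outcome of the noise\<close>

lemma repeat_vertex_query_support:
  assumes "(rs, h') \<in> set_pmf (repeat_query k (vertex_query p t adv v) h)"
  shows "length rs = k \<and> num_vertex_queries h' = num_vertex_queries h + k
    \<and> num_edge_queries h' = num_edge_queries h \<and> (\<forall>r\<in>set rs. \<exists>h i. r = answer h i v)"
  using assms
  by (induction k arbitrary: h rs h') (fastforce simp: vertex_query_altdef)+

lemma repeat_edge_query_support:
  assumes "(bs, h') \<in> set_pmf (repeat_query k (edge_query G w p t v u) h)"
  shows "length bs = k \<and> num_vertex_queries h' = num_vertex_queries h
    \<and> num_edge_queries h' = num_edge_queries h + k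
    \<and> (\<forall>b\<in>set bs. \<exists>i. b = (t i \<in> direction G w v u))"
  using assms
  by (induction k arbitrary: h bs h') (fastforce simp: edge_query_altdef)+

lemma test_edges_support:
  assumes "(res, h') \<in> set_pmf (test_edges G w p t v us h)"
  shows "set_option res \<subseteq> set us \<and> num_vertex_queries h' = num_vertex_queries h
    \<and> num_edge_queries h' \<le> num_edge_queries h + length us * L"
  using assms
proof (induction us arbitrary: h)
  case (Cons u us)
  then obtain bs h1 where 1: "(bs, h1) \<in> set_pmf (repeat_query L (edge_query G w p t v u) h)"
    and 2: "(res, h') \<in> set_pmf (if set bs = {True} then return_pmf (Some u, h1)
      else test_edges G w p t v us h1)"
    by auto
  show ?case
    using repeat_edge_query_support[OF 1] 2 Cons.IH[of h1]
    by (cases "set bs = {True}") auto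
qed auto

text \<open>\<open>L\<close> vertex queries give at most \<open>L\<close> distinct neighbors, and
  each of these is tested with \<open>L\<close> edge queries.\<close>

lemma num_queries_iteration:
  assumes "(out, h') \<in> set_pmf (iteration G w p t adv med pick S h)"
  shows "num_vertex_queries h' = num_vertex_queries h + L
    \<and> num_edge_queries h' \<le> num_edge_queries h + L * L"
proof -
  let ?v = "med h S"
  obtain rs h1 where 1: "(rs, h1) \<in> set_pmf (repeat_query L (vertex_query p t adv ?v) h)"
    and 2: "h' = h1 \<or> (\<exists>res. (res, h') \<in> set_pmf (test_edges G w p t ?v (distinct_neighbors rs) h1))"
    using assms by (auto simp: iteration_def Let_def split: if_splits; blast)
  note h1 = repeat_vertex_query_support[OF 1]
  have le: "length (distinct_neighbors rs) * L \<le> L * L"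
    using h1 length_distinct_neighbors_le[of rs] by simp
  from 2 show ?thesis
  proof (elim disjE exE)
    fix res
    assume "(res, h') \<in> set_pmf (test_edges G w p t ?v (distinct_neighbors rs) h1)"
    from test_edges_support[OF this] h1 le show ?thesis by linarith
  qed (use h1 in simp)
qed

section \<open>Answers at a vertex and the outcome of the edge tests\<close>

lemma response_answer:
  assumes "(rs, h') \<in> set_pmf (repeat_query k (vertex_query p t adv v) h)" "r \<in> set rs"
  obtains h'' i where "r = answer h'' i v"
  using repeat_vertex_query_support[OF assms(1)] assms(2) by metis

lemma Is_Target_response:
  assumes "(rs, h') \<in> set_pmf (repeat_query k (vertex_query p t adv v) h)" "Is_Target i \<in> set rs"
  shows "v = t i"
  using assms by (rule response_answer) (simp add: answer_def split: if_splits)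

text \<open>Every returned neighbor points towards one of the targets, so one outside $E_{t_1}(v)$
  must point towards the second.\<close>

lemma Neighbor_response:
  assumes "(rs, h') \<in> set_pmf (repeat_query k (vertex_query p t adv v) h)" "Neighbor u \<in> set rs"
    and "v \<in> pverts G"
  shows "u \<in> towards G w (t First) v \<or> u \<in> towards G w (t Second) v"
proof -
  from assms(1,2) obtain h'' i where "Neighbor u = answer h'' i v" by (rule response_answer)
  then have "u \<in> towards G w (t i) v"
    using adv_towards[OF assms(3), of i h''] by (simp add: answer_def split: if_splits)
  then show ?thesis by (cases i) auto
qed

lemma expected_first_hit_cost_responses:
  assumes "v \<in> pverts G" "c \<ge> 0"
  shows "(\<integral>\<^sup>+(rs, h'). ennreal (first_hit_cost (helpful v) c rs)
      \<partial>measure_pmf (repeat_query k (vertex_query p t adv v) h))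
    \<le> ennreal (p ^ k + c * p / (1 - p))"
proof (induction k arbitrary: h)
  case 0
  then show ?case using p assms(2) by simp
next
  case (Suc k)
  let ?q = "vertex_query p t adv v" and ?f = "first_hit_cost (helpful v) c"
  let ?I = "\<lambda>h. \<integral>\<^sup>+(rs, h'). ennreal (?f rs) \<partial>measure_pmf (repeat_query k ?q h)"
  let ?J = "\<lambda>r h. \<integral>\<^sup>+(rs, h'). ennreal (?f (r # rs)) \<partial>measure_pmf (repeat_query k ?q h)"
  let ?h = "\<lambda>i. Vertex_Query v i (answer h i v) # h"
  have J: "?J r h \<le> ennreal c + ?I h" for r h
  proof -
    have "?J r h \<le> (\<integral>\<^sup>+x. ennreal c + (case x of (rs, h') \<Rightarrow> ennreal (?f rs))
        \<partial>measure_pmf (repeat_query k ?q h))"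
      using assms(2)
      by (intro nn_integral_mono) (auto simp: first_hit_cost_nonneg split: prod.splits)
    also have "\<dots> = ennreal c + ?I h"
      by (simp add: nn_integral_add measure_pmf.emeasure_space_1[simplified])
    finally show ?thesis .
  qed
  \<comment> \<open>A query hitting \<open>Second\<close> is helpful whatever the adversary does, so
    only the \<open>First\<close> branch contributes.\<close>
  have J0: "?J (answer h Second v) h' = 0" for h'
    using helpful_answer_Second[OF assms(1)] by (simp add: case_prod_unfold)
  have "(\<integral>\<^sup>+(rs, h'). ennreal (?f rs) \<partial>measure_pmf (repeat_query (Suc k) ?q h))
      = (\<integral>\<^sup>+i. ?J (answer h i v) (?h i) \<partial>measure_pmf (choose_target p))"
    by (simp add: vertex_query_altdef case_prod_unfold)
  also have "\<dots> = ennreal p * ?J (answer h First v) (?h First)"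
    using p by (subst nn_integral_choose_target) (simp_all only: J0, simp_all)
  also have "\<dots> \<le> ennreal p * (ennreal c + ennreal (p ^ k + c * p / (1 - p)))"
    by (intro mult_left_mono order_trans[OF J] add_left_mono Suc.IH) auto
  also have "\<dots> = ennreal (p * (c + (p ^ k + c * p / (1 - p))))"
    using p assms(2) by (simp add: ennreal_plus[symmetric] ennreal_mult del: ennreal_plus)
  \<comment> \<open>The bound solves the recursion exactly: \<open>c * p / (1 - p)\<close> is the
    fixed point of the map taking \<open>a\<close> to \<open>p * (c + a)\<close>.\<close>
  also have "p * (c + (p ^ k + c * p / (1 - p))) = p ^ Suc k + c * p / (1 - p)"
    using p by (simp add: field_simps)
  finally show ?case .
qed

text \<open>For a wrong \<open>u\<close> a YES can only come from the hidden target
  \<open>First\<close>, so each query says YES with probability at most \<open>p\<close>. Inclusion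
  in \<open>{True}\<close> instead of equality lets the induction start at the empty list.\<close>

lemma all_yes_le:
  assumes "\<not> leads_to_second v u"
  shows "emeasure (measure_pmf (repeat_query k (edge_query G w p t v u) h)) {(bs, h'). set bs \<subseteq> {True}}
    \<le> ennreal (p ^ k)"
proof (induction k arbitrary: h)
  case 0
  then show ?case by simp
next
  case (Suc k)
  let ?q = "edge_query G w p t v u" and ?A = "{(bs, h'). set bs \<subseteq> {True}}"
  let ?F = "\<lambda>i h. emeasure (measure_pmf (map_pmf (\<lambda>(bs, h'). ((t i \<in> direction G w v u) # bs, h'))
    (repeat_query k ?q h))) ?A"
  let ?h = "\<lambda>i. Edge_Query v u i (t i \<in> direction G w v u) # h"
  have F: "?F i h \<le> (if i = Second then 0 else ennreal (p ^ k))" for i h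
  proof (cases "t i \<in> direction G w v u")
    case True
    then have "?F i h = emeasure (measure_pmf (repeat_query k ?q h)) ?A"
      by (simp add: emeasure_map_pmf vimage_def case_prod_unfold)
    with True show ?thesis using Suc.IH[of h] assms by (cases i) auto
  next
    case False
    then have "?F i h = 0"
      by (simp add: emeasure_map_pmf vimage_def case_prod_unfold)
    then show ?thesis by simp
  qed
  have "emeasure (measure_pmf (repeat_query (Suc k) ?q h)) ?A
      = (\<integral>\<^sup>+i. ?F i (?h i) \<partial>measure_pmf (choose_target p))"
    by (simp add: edge_query_altdef map_pmf_def case_prod_unfold)
  also have "\<dots> = ennreal p * ?F First (?h First) + ennreal (1 - p) * ?F Second (?h Second)"
    using p by (simp only: nn_integral_choose_target less_imp_le)
  also have "\<dots> \<le> ennreal p * ennreal (p ^ k) + ennreal (1 - p) * 0"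
    using F[of First "?h First"] F[of Second "?h Second"] 
    by (intro add_mono mult_left_mono) simp_all
  also have "\<dots> = ennreal (p ^ Suc k)"
    using p by (simp add: ennreal_mult)
  finally show ?case .
qed

text \<open>The tests run through the list as in \<open>first_hit_cost\<close>: a right candidate
  always passes, a wrong one passes with probability at most \<open>p ^ L\<close>, and otherwise the
  next one is tested.\<close>

lemma test_edges_failure_le:
  assumes "L > 0" "set us \<subseteq> towards G w (t First) v"
  shows "emeasure (measure_pmf (test_edges G w p t v us h))
      {(res, h'). \<not> (\<exists>u. res = Some u \<and> leads_to_second v u)}
    \<le> ennreal (first_hit_cost (leads_to_second v) (p ^ L) us)"
  using assms(2)
proof (induction us arbitrary: h)
  case Nil
  then show ?case by simp
next
  case (Cons u us)
  let ?B = "{(res, h' :: 'a transcript). \<not> (\<exists>u. res = Some u \<and> leads_to_second v u)}"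
  let ?A = "{(bs, h' :: 'a transcript). set bs \<subseteq> {True}}"
  let ?M = "repeat_query L (edge_query G w p t v u) h"
  let ?N = "\<lambda>(bs, h'). if set bs = {True} then return_pmf (Some u, h')
      else test_edges G w p t v us h'"
  have u: "t First \<in> direction G w v u" and us: "set us \<subseteq> towards G w (t First) v"
    using Cons.prems by (auto simp: towards_def)
  have eq: "test_edges G w p t v (u # us) h = bind_pmf ?M ?N" by simp
  show ?case
  proof (cases "leads_to_second v u")
    case True
    \<comment> \<open>Both targets lie in this direction, so the answer is YES whichever target is
      hidden.\<close>
    have all: "t i \<in> direction G w v u" for i using u True by (cases i) auto
    have "emeasure (measure_pmf (?N x)) ?B \<le> 0" if "x \<in> set_pmf ?M" for x
    proof -
      obtain bs h' where x: "x = (bs, h')" by force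
      have "length bs = L" "set bs \<subseteq> {True}"
        using repeat_edge_query_support[of bs h' L v u h] that all unfolding x by auto
      \<comment> \<open>Needs \<open>L > 0\<close>: an empty list of answers would not count as
        passing.\<close>
      then have "set bs = {True}" using assms(1) by (cases bs) auto
      with True x show ?thesis by simp
    qed
    from emeasure_bind_pmf_le_nn_integral[of ?M ?N ?B "\<lambda>_. 0", OF this] show ?thesis
      unfolding eq by simp
  next
    case False
    have "emeasure (measure_pmf (bind_pmf ?M ?N)) ?B
        \<le> emeasure (measure_pmf ?M) ?A + ennreal (first_hit_cost (leads_to_second v) (p ^ L) us)"
      by (rule emeasure_bind_pmf_le_add) (use Cons.IH[OF us] in \<open>auto split: if_splits\<close>)
    also have "\<dots> \<le> ennreal (p ^ L) + ennreal (first_hit_cost (leads_to_second v) (p ^ L) us)"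
      by (intro add_right_mono all_yes_le False)
    also have "\<dots> = ennreal (first_hit_cost (leads_to_second v) (p ^ L) (u # us))"
      using False p by (simp add: first_hit_cost_nonneg)
    finally show ?thesis
      unfolding eq .
  qed
qed

text \<open>Passes from all responses to the list actually tested: dropping repetitions and
  \<open>Is_Target First\<close> removes only bad entries before the first good one.\<close>

lemma first_hit_cost_distinct_neighbors:
  assumes "c \<ge> 0" "Is_Target Second \<notin> set rs"
  shows "first_hit_cost (leads_to_second v) c (distinct_neighbors rs) \<le> first_hit_cost (helpful v) c rs"
  using assms(2)
proof (induction rs)
  case (Cons r rs)
  then show ?case
  proof (cases r)
    case (Neighbor u)
    then show ?thesis
      using Cons first_hit_cost_removeAll[OF assms(1), of "leads_to_second v" u "distinct_neighbors rs"]
      by auto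
  next
    case (Is_Target i)
    then show ?thesis using Cons assms(1) by (cases i) auto
  qed
qed simp

section \<open>Progress of one iteration and failure of the whole loop\<close>

primrec progress :: "'a set \<Rightarrow> 'a outcome \<Rightarrow> bool" where
  "progress S (Detected x) \<longleftrightarrow> x = t Second"
| "progress S (Candidates S') \<longleftrightarrow>
     S' \<subseteq> S \<and> t Second \<in> S' \<and> real (card S') \<le> (1 + \<epsilon>) / 2 * real (card S)"

text \<open>Given the responses, the iteration fails with probability at most their
  \<open>first_hit_cost\<close>: detecting the second target or finding a response outside
  $E_{t_1}(v)$ is always progress, and otherwise the edge tests decide. Averaging over the responses
  gives the bound.\<close>

lemma iteration_failure_le:
  assumes "S \<subseteq> pverts G" "t Second \<in> S" "card S > 1"
  shows "emeasure (measure_pmf (iteration G w p t adv med pick S h)) {(out, h'). \<not> progress S out}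
    \<le> ennreal (p ^ L / (1 - p))"
proof -
  let ?B = "{(out, h' :: 'a transcript). \<not> progress S out}"
  let ?v = "med h S"
  let ?E = "towards G w (t First) ?v"
  let ?M = "repeat_query L (vertex_query p t adv ?v) h"
  let ?N = "\<lambda>(rs, h'). if Is_Target Second \<in> set rs then return_pmf (Detected ?v, h')
       else if \<exists>u \<in> set (distinct_neighbors rs). u \<notin> ?E then
         return_pmf (Candidates (S \<inter> direction G w ?v (pick h' (set (distinct_neighbors rs) - ?E))), h')
       else bind_pmf (test_edges G w p t ?v (distinct_neighbors rs) h')
         (\<lambda>(res, h''). return_pmf
           (Candidates (case res of None \<Rightarrow> S | Some u \<Rightarrow> S \<inter> direction G w ?v u), h''))"
  have "card S \<le> card (pverts G)" using assms(1) by (intro card_mono) auto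
  with assms(3) have n: "card (pverts G) > 1" by simp
  have L: "L > 0" using n by (simp add: num_repetitions_def)
  have median: "approx_median G w \<epsilon> S ?v"
    using med assms(1,3) by (simp add: correct_median_rule_def)
  then have v: "?v \<in> pverts G" by (simp add: approx_median_def)
  have progress: "progress S (Candidates (S \<inter> direction G w ?v u))"
    if "u \<in> neighbors G ?v" "leads_to_second ?v u" for u
    using approx_median_direction_le[OF median assms(1) n \<epsilon>(1) that(1)] that(2) assms(2) by simp
  have "emeasure (measure_pmf (?N x)) ?B
      \<le> (case x of (rs, h') \<Rightarrow> ennreal (first_hit_cost (helpful ?v) (p ^ L) rs))"
    if "x \<in> set_pmf ?M" for x
  proof -
    obtain rs h' where x: "x = (rs, h')" by force
    note sup = that[unfolded x]
    let ?Q = "distinct_neighbors rs"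
    consider "Is_Target Second \<in> set rs"
      | "Is_Target Second \<notin> set rs" "\<exists>u \<in> set ?Q. u \<notin> ?E"
      | "Is_Target Second \<notin> set rs" "set ?Q \<subseteq> ?E"
      by blast
    then show ?thesis
    proof cases
      case 1
      then show ?thesis using Is_Target_response[OF sup] by (simp add: x)
    next
      case 2
      define u where "u = pick h' (set ?Q - ?E)"
      have "u \<in> set ?Q - ?E"
        using pick 2(2) unfolding u_def correct_pick_rule_def by blast
      \<comment> \<open>Every response points towards some target; this one does not point towards
        the first.\<close>
      then have "u \<in> towards G w (t Second) ?v"
        using Neighbor_response[OF sup _ v, of u] by (auto simp: set_distinct_neighbors)
      then have "progress S (Candidates (S \<inter> direction G w ?v u))"
        by (intro progress) (auto simp: towards_def)
      then show ?thesis using 2 by (simp add: x u_def[symmetric] del: progress.simps)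
    next
      case 3
      let ?C = "{(res, h' :: 'a transcript). \<not> (\<exists>u. res = Some u \<and> leads_to_second ?v u)}"
      have "emeasure (measure_pmf (?N x)) ?B
          \<le> emeasure (measure_pmf (test_edges G w p t ?v ?Q h')) ?C + 0"
      proof -
        have *: "emeasure (measure_pmf (case z of (res, h'') \<Rightarrow> return_pmf
           (Candidates (case res of None \<Rightarrow> S | Some u \<Rightarrow> S \<inter> direction G w ?v u), h''))) ?B \<le> 0"
          if z: "z \<in> set_pmf (test_edges G w p t ?v ?Q h')" "z \<notin> ?C" for z
        proof -
          obtain u h'' where u: "z = (Some u, h'')" "leads_to_second ?v u" using z(2) by auto
          then have "u \<in> ?E" using test_edges_support[of "Some u" h''] z(1) 3(2) by auto
          then have "progress S (Candidates (S \<inter> direction G w ?v u))"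
            using u(2) by (intro progress) (auto simp: towards_def)
          then show ?thesis using u(1) by (simp del: progress.simps)
        qed
        have "\<not> (\<exists>u\<in>set ?Q. u \<notin> ?E)" using 3 by auto
        with 3(1) show ?thesis
          unfolding x by (simp only: if_False prod.case) (rule emeasure_bind_pmf_le_add, rule *)
      qed
      also have "\<dots> \<le> ennreal (first_hit_cost (leads_to_second ?v) (p ^ L) ?Q)"
        using test_edges_failure_le[OF L 3(2)] by simp
      also have "\<dots> \<le> ennreal (first_hit_cost (helpful ?v) (p ^ L) rs)"
        using first_hit_cost_distinct_neighbors[OF _ 3(1)] p by (intro ennreal_leI) simp
      finally show ?thesis by (simp add: x)
    qed
  qed
  then have "emeasure (measure_pmf (bind_pmf ?M ?N)) ?B
      \<le> (\<integral>\<^sup>+(rs, h'). ennreal (first_hit_cost (helpful ?v) (p ^ L) rs) \<partial>measure_pmf ?M)"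
    by (rule emeasure_bind_pmf_le_nn_integral)
  also have "\<dots> \<le> ennreal (p ^ L + p ^ L * p / (1 - p))"
    using p by (intro expected_first_hit_cost_responses[OF v]) simp
  also have "p ^ L + p ^ L * p / (1 - p) = p ^ L / (1 - p)"
    using p by (simp add: field_simps)
  finally show ?thesis
    by (simp only: iteration_def Let_def)
qed

text \<open>Induction on a budget of \<open>k\<close> iterations, with a union bound over their
  failures. The complement is taken in the option type, so failure includes non-termination, and
  unfolding the loop along the budget needs no separate termination argument.\<close>

lemma search_failure_le:
  assumes "S \<subseteq> pverts G" "t Second \<in> S" "real (card S) * ((1 + \<epsilon>) / 2) ^ k < 2"
  shows "emeasure (measure_pmf (search G w p t adv med pick S h))
      (- Some ` {(res, h'). res = Some (t Second)
        \<and> num_vertex_queries h' \<le> num_vertex_queries h + k * L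
        \<and> num_edge_queries h' \<le> num_edge_queries h + k * (L * L)})
    \<le> ennreal (real k * (p ^ L / (1 - p)))"
proof -
  have singleton: "S = {t Second}" if "S \<subseteq> pverts G" "t Second \<in> S" "card S < 2" for S
    using that card_le_Suc0_iff_eq[OF finite_subset[OF that(1) pair_finite_verts]] by auto
  from assms show ?thesis
  proof (induction k arbitrary: S h)
    case (0 S h)
    then have "S = {t Second}" by (intro singleton) auto
    then show ?case by (subst search.simps) simp
  next
    case (Suc k S h)
    let ?c = "(1 + \<epsilon>) / 2" and ?\<delta> = "p ^ L / (1 - p)"
    show ?case
    proof (cases "card S > 1")
      \<comment> \<open>The loop may stop before the budget is used up; it then returns at once
        without further queries.\<close>
      case False
      then have "S = {t Second}" using Suc.prems by (intro singleton) auto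
      then show ?thesis by (subst search.simps) simp
    next
      case True
      let ?G = "\<lambda>k h. {(res, h'). res = Some (t Second)
          \<and> num_vertex_queries h' \<le> num_vertex_queries h + k * L
          \<and> num_edge_queries h' \<le> num_edge_queries h + k * (L * L)}"
      let ?M = "iteration G w p t adv med pick S h"
      let ?N = "\<lambda>(res, h'). case res of Detected x \<Rightarrow> return_spmf (Some x, h')
         | Candidates S' \<Rightarrow> search G w p t adv med pick S' h'"
      have "emeasure (measure_pmf (bind_pmf ?M ?N)) (- Some ` ?G (Suc k) h)
        \<le> emeasure (measure_pmf ?M) {(out, h'). \<not> progress S out} + ennreal (real k * ?\<delta>)"
      proof (rule emeasure_bind_pmf_le_add)
        fix x assume x: "x \<in> set_pmf ?M" "x \<notin> {(out, h'). \<not> progress S out}"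
        obtain out h' where out: "x = (out, h')" by force
        have h': "num_vertex_queries h' = num_vertex_queries h + L"
          "num_edge_queries h' \<le> num_edge_queries h + L * L"
          using num_queries_iteration[of out h' S h] x(1) out by auto
        show "emeasure (measure_pmf (?N x)) (- Some ` ?G (Suc k) h) \<le> ennreal (real k * ?\<delta>)"
        proof (cases out)
          case (Detected y)
          then show ?thesis using x(2) h' by (simp add: out)
        next
          case (Candidates S')
          then have S': "S' \<subseteq> S" "t Second \<in> S'" "real (card S') \<le> ?c * real (card S)"
            using x(2) out by auto
          have "real (card S') * ?c ^ k \<le> ?c * real (card S) * ?c ^ k"
            using S'(3) \<epsilon> by (intro mult_right_mono) auto
          also have "\<dots> < 2" using Suc.prems(3) by (simp add: mult_ac)
          finally have "emeasure (measure_pmf (search G w p t adv med pick S' h')) (- Some ` ?G k h')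
              \<le> ennreal (real k * ?\<delta>)"
            using Suc.IH[of S' h'] S' Suc.prems(1) by auto
          \<comment> \<open>The queries of this iteration fit into one share of the budget, so a run
            within budget \<open>k\<close> from \<open>h'\<close> is within budget
            \<open>Suc k\<close> from \<open>h\<close>.\<close>
          moreover have "emeasure (measure_pmf R) (- Some ` ?G (Suc k) h)
              \<le> emeasure (measure_pmf R) (- Some ` ?G k h')" for R
            using h' by (intro emeasure_mono) auto
          ultimately have "emeasure (measure_pmf (search G w p t adv med pick S' h')) (- Some ` ?G (Suc k) h)
              \<le> ennreal (real k * ?\<delta>)"
            by (rule order_trans[rotated])
          then show ?thesis by (simp only: out Candidates prod.case outcome.case)
        qed
      qed
      also have "\<dots> \<le> ennreal ?\<delta> + ennreal (real k * ?\<delta>)"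
        using iteration_failure_le[OF Suc.prems(1,2) True] by (intro add_right_mono)
      also have "\<dots> = ennreal (real (Suc k) * ?\<delta>)"
        using p by (simp add: distrib_right flip: ennreal_plus del: times_divide_eq_right)
      also have "bind_pmf ?M ?N = search G w p t adv med pick S h"
        using True by (subst (2) search.simps) simp
      finally show ?thesis .
    qed
  qed
qed

text \<open>Complement of the failure bound, started at \<open>S = pverts G\<close> with an empty
  transcript.\<close>

lemma algorithm_E_success_ge:
  assumes "real (card (pverts G)) * ((1 + \<epsilon>) / 2) ^ k < 2"
  shows "measure (measure_spmf (algorithm_E G w p t adv med pick))
      {(res, h). res = Some (t Second) \<and> num_vertex_queries h \<le> k * L
        \<and> num_edge_queries h \<le> k * (L * L)}
    \<ge> 1 - real k * (p ^ L / (1 - p))"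
proof -
  let ?X = "{(res, h). res = Some (t Second) \<and> num_vertex_queries h \<le> k * L
        \<and> num_edge_queries h \<le> k * (L * L)}"
  let ?M = "measure_pmf (algorithm_E G w p t adv med pick)"
  have "emeasure ?M (- Some ` ?X) \<le> ennreal (real k * (p ^ L / (1 - p)))"
    using search_failure_le[OF subset_refl targets assms, of "[]"] by (simp add: algorithm_E_def)
  then have "measure ?M (- Some ` ?X) \<le> real k * (p ^ L / (1 - p))"
    using p by (simp add: measure_pmf.emeasure_eq_measure)
  then show ?thesis
    using measure_pmf.prob_compl[of "Some ` ?X" "algorithm_E G w p t adv med pick"]
    by (simp add: measure_measure_spmf_conv_measure_pmf Compl_eq_Diff_UNIV)
qed

end

theorem theorem9:
  fixes p1 p2 \<epsilon> :: real
  assumes "p1 > p2" and "p2 = 1 - p1" and "p2 > 0"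
    and "0 \<le> \<epsilon>" and "\<epsilon> < 1"
  shows "\<exists>C1 C2 C3 :: real.
    \<forall>(G :: nat pair_pre_digraph) w (t :: target \<Rightarrow> nat) adv med pick.
      weighted_graph G w \<longrightarrow> (\<forall>i. t i \<in> pverts G) \<longrightarrow>
      correct_adversary G w t adv \<longrightarrow> correct_median_rule G w \<epsilon> med \<longrightarrow> correct_pick_rule pick \<longrightarrow>
      (let n = real (card (pverts G)) in
        measure (measure_spmf (algorithm_E G w p1 t adv med pick))
          {(res, h). res = Some (t Second)
             \<and> real (num_vertex_queries h) \<le> C1 * (log 2 n) ^ 2
             \<and> real (num_edge_queries h) \<le> C2 * (log 2 n) ^ 3}
        \<ge> 1 - C3 * (log 2 n * p1 powr (log 2 n)))"
proof -
  define c where "c = (1 + \<epsilon>) / 2"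
  have c: "0 < c" "c < 1" and p1: "0 < p1" "p1 < 1" using assms by (auto simp: c_def)
  \<comment> \<open>About \<open>l / log 2 (1 / c)\<close> contractions by \<open>c\<close> exhaust
    \<open>n = 2 powr l\<close> vertices; the summand 1 pays for rounding up.\<close>
  define D where "D = 1 / log 2 (1 / c) + 1"
  have logc: "log 2 (1 / c) > 0" using c by simp
  then have D: "D \<ge> 0" by (simp add: D_def)
  \<comment> \<open>With \<open>k \<le> D * l\<close> and \<open>L \<le> 2 * l\<close>, the products
    \<open>k * L\<close> and \<open>k * L * L\<close> give the first two constants; the third comes
    from \<open>k / (1 - p1)\<close>.\<close>
  show ?thesis
  proof (rule exI[of _ "2 * D"], rule exI[of _ "4 * D"], rule exI[of _ "D / (1 - p1)"], intro allI impI)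
    fix G :: "nat pair_pre_digraph" and w and t :: "target \<Rightarrow> nat" and adv med
      and pick :: "nat pick_rule"
    assume "weighted_graph G w" "\<forall>i. t i \<in> pverts G" "correct_adversary G w t adv"
      "correct_median_rule G w \<epsilon> med" "correct_pick_rule pick"
    then interpret two_target_search G w p1 \<epsilon> t adv med pick
      using assms by unfold_locales auto
    define n where "n = card (pverts G)"
    define l where "l = log 2 (real n)"
    define k where "k = nat \<lceil>l / log 2 (1 / c)\<rceil>"
    have n: "n \<ge> 1"
      using targets[of Second] card_gt_0_iff[of "pverts G"] by (fastforce simp: n_def Suc_le_eq)
    then have l0: "l \<ge> 0" by (simp add: l_def)
    \<comment> \<open>For \<open>n = 1\<close> all bounds vanish, as do \<open>k\<close> and
      \<open>L\<close>. Otherwise \<open>l \<ge> 1\<close>, so rounding up costs only a constant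
      factor.\<close>
    have l_cases: "l = 0 \<or> l \<ge> 1"
    proof (cases "n = 1")
      case False
      then have "log 2 2 \<le> log 2 (real n)" using n by (subst log_le_cancel_iff) auto
      then show ?thesis by (simp add: l_def)
    qed (simp add: l_def)
    have L_ge: "l \<le> real L" and L_le: "real L \<le> 2 * l"
      using l0 l_cases unfolding num_repetitions_def n_def[symmetric] l_def[symmetric]
      by (auto, linarith+)
    have k_ge: "l \<le> real k * log 2 (1 / c)"
      using logc real_nat_ceiling_ge[of "l / log 2 (1 / c)"]
      by (simp add: k_def field_simps)
    have k_le: "real k \<le> D * l"
    proof (cases "l = 0")
      case False
      have "real k \<le> l / log 2 (1 / c) + 1"
        using l0 logc unfolding k_def by (simp add: of_nat_ceiling)
      also have "\<dots> \<le> l / log 2 (1 / c) + l" using False l_cases by simp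
      finally show ?thesis by (simp add: D_def algebra_simps)
    qed (simp add: k_def)
    \<comment> \<open>By the choice of \<open>k\<close> this is at most 0, so \<open>k\<close>
      contractions leave fewer than two vertices.\<close>
    have "log 2 (real n * c ^ k) = l - real k * log 2 (1 / c)"
      using n c by (simp add: l_def log_mult log_nat_power log_divide)
    also have "\<dots> < 1" using k_ge by simp
    finally have "real n * c ^ k < 2"
      using n c by (simp add: log_less_iff)
    then have "1 - real k * (p1 ^ L / (1 - p1)) \<le>
        measure (measure_spmf (algorithm_E G w p1 t adv med pick))
          {(res, h). res = Some (t Second) \<and> num_vertex_queries h \<le> k * L
            \<and> num_edge_queries h \<le> k * (L * L)}"
      by (intro algorithm_E_success_ge) (simp add: n_def c_def)
    also have "\<dots> \<le> measure (measure_spmf (algorithm_E G w p1 t adv med pick))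
          {(res, h). res = Some (t Second) \<and> real (num_vertex_queries h) \<le> 2 * D * l ^ 2
             \<and> real (num_edge_queries h) \<le> 4 * D * l ^ 3}"
    proof (intro measure_spmf.finite_measure_mono)
      have kL: "real k * real L \<le> (D * l) * (2 * l)"
        using k_le L_le D l0 by (intro mult_mono) auto
      then have "real k * real L * real L \<le> (D * l) * (2 * l) * (2 * l)"
        using L_le D l0 by (intro mult_mono[OF kL]) auto
      then have *: "real (k * (L * L)) \<le> 4 * D * l ^ 3" "real (k * L) \<le> 2 * D * l ^ 2"
        using kL by (simp_all add: power2_eq_square power3_eq_cube mult_ac)
      show "{(res, h). res = Some (t Second) \<and> num_vertex_queries h \<le> k * L
            \<and> num_edge_queries h \<le> k * (L * L)} \<subseteq>
          {(res, h). res = Some (t Second) \<and> real (num_vertex_queries h) \<le> 2 * D * l ^ 2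
             \<and> real (num_edge_queries h) \<le> 4 * D * l ^ 3}"
        using * by (auto intro: order_trans[OF of_nat_mono])
    qed simp
    also have "1 - D / (1 - p1) * (l * p1 powr l) \<le> 1 - real k * (p1 ^ L / (1 - p1))"
    proof -
      have "p1 ^ L = p1 powr real L" using p1 by (simp add: powr_realpow)
      \<comment> \<open>Rounding the number of repetitions up only helps, since
        \<open>p1 < 1\<close>.\<close>
      also have "\<dots> \<le> p1 powr l" using p1 L_ge by (intro powr_mono') auto
      finally have "real k * (p1 ^ L / (1 - p1)) \<le> (D * l) * (p1 powr l / (1 - p1))"
        using k_le D l0 p1 by (intro mult_mono divide_right_mono) auto
      then show ?thesis by simp
    qed
    finally show "let n = real (card (pverts G)) in
        measure (measure_spmf (algorithm_E G w p1 t adv med pick))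
          {(res, h). res = Some (t Second)
             \<and> real (num_vertex_queries h) \<le> 2 * D * (log 2 n) ^ 2
             \<and> real (num_edge_queries h) \<le> 4 * D * (log 2 n) ^ 3}
        \<ge> 1 - D / (1 - p1) * (log 2 n * p1 powr (log 2 n))"
      by (simp add: n_def l_def Let_def)
  qed
qed

end
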